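(* Let $C_+^{(4)}=\{(x_1,x_2)\in\mathbb{R}^2\colon 0<x_2<x_1\}$. Uniformly in $x=(x_1,x_2)\in C_+^{(4)}$, $y=(y_1,y_2)\in C_+^{(4)}$, and $t>0$, $$ p_t^{\det,C_+^{(4)}}(x,y)\simeq \frac{x_1y_1}{x_1y_1+t}\cdot\frac{x_2y_2}{x_2y_2+t}\cdot\frac{(x_1-x_2)(y_1-y_2)}{(x_1-x_2)(y_1-y_2)+t}\cdot\frac{(x_1+x_2)(y_1+y_2)}{(x_1+x_2)(y_1+y_2)+t}\;p_t^{(2)}(x-y). $$
   Context: $p_t^{(2)}(w)=(4\pi t)^{-1}\exp(-\|w\|^2/4t)$, $w\in\mathbb{R}^2$, is the Gauss-Weierstrass kernel. Identify $\mathbb{R}^2\simeq\mathbb{C}$. The dihedral root system $I_2(4)$ is $\{e^{i\pi j/4}\colon j=0,\dots,7\}$, and $W=W(I_2(4))\subset O(2)$ is the group (of order 8) generated by the orthogonal reflections in the lines perpendicular to the vectors of $I_2(4)$; equivalently, $W$ consists of all maps $(x_1,x_2)\mapsto(\varepsilon_1x_1,\varepsilon_2x_2)$ and $(x_1,x_2)\mapsto(\varepsilon_1x_2,\varepsilon_2x_1)$ with $\varepsilon_1,\varepsilon_2\in\{1,-1\}$. The open cone $C_+^{(4)}=\{\rho e^{i\theta}\colon\rho>0,\ 0<\theta<\pi/4\}=\{(x_1,x_2)\colon 0<x_2<x_1\}$ is a Weyl chamber for $I_2(4)$. The kernel $p_t^{\det,C_+^{(4)}}$ is the Dirichlet heat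 kernel on $C_+^{(4)}$ (the integral kernel of $e^{t\Delta}$ with $\Delta$ the Dirichlet Laplacian on $C_+^{(4)}$); it is given, for $x,y\in C_+^{(4)}$ and $t>0$, by $$p_t^{\det,C_+^{(4)}}(x,y)=\sum_{g\in W}\det(g)\,p_t^{(2)}(gx-y).$$ $X\simeq Y$ uniformly in the indicated variables means that there is a constant $C>0$, independent of $x,y,t$, with $C^{-1}Y\le X\le CY$. *)

theory Defs
  imports "HOL-Analysis.Analysis" "HOL-Algebra.Generated_Groups" "HOL-Algebra.Bij"
begin

definition gauss_weierstrass :: "real \<Rightarrow> real^2 \<Rightarrow> real" where
  "gauss_weierstrass t w = inverse (4 * pi * t) * exp (- ((norm w)\<^sup>2 / (4 * t)))"

text \<open>\<open>C\<close> is identified with \<open>real^2\<close>, so that \<open>exp (\<i> * \<theta>)\<close> is the vector \<open>(cos \<theta>, sin \<theta>)\<close>.\<close>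

definition I2_4 :: "(real^2) set" where
  "I2_4 = {vector [cos (pi * real j / 4), sin (pi * real j / 4)] | j::nat. j \<in> {0..7}}"

definition reflection :: "real^2 \<Rightarrow> real^2 \<Rightarrow> real^2" where
  "reflection \<alpha> x = x - (2 * (x \<bullet> \<alpha>) / (\<alpha> \<bullet> \<alpha>)) *\<^sub>R \<alpha>"

definition weyl_group_I2_4 :: "(real^2 \<Rightarrow> real^2) set" where
  "weyl_group_I2_4 = generate (BijGroup UNIV) (reflection ` I2_4)"

definition weyl_chamber_I2_4 :: "(real^2) set" where
  "weyl_chamber_I2_4 = {x. 0 < x$2 \<and> x$2 < x$1}"

text \<open>The Dirichlet heat kernel of the chamber, given by the alternating sum over the Weyl group
  (method of images). The sum is over a finite set, see \<open>finite_weyl_group_I2_4\<close> below.\<close>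

definition heat_kernel_det_I2_4 :: "real \<Rightarrow> real^2 \<Rightarrow> real^2 \<Rightarrow> real" where
  "heat_kernel_det_I2_4 t x y =
     (\<Sum>g\<in>weyl_group_I2_4. det (matrix g) * gauss_weierstrass t (g x - y))"


definition signed_perms :: "(real^2 \<Rightarrow> real^2) set" where
  "signed_perms =
     {\<lambda>x. vector [a * x$1, b * x$2] | a b. a \<in> {1, -1} \<and> b \<in> {1, -1}} \<union>
     {\<lambda>x. vector [a * x$2, b * x$1] | a b. a \<in> {1, -1} \<and> b \<in> {1, -1}}"

lemma signed_perms_diag:
  "a \<in> {1, -1} \<Longrightarrow> b \<in> {1, -1} \<Longrightarrow> (\<lambda>x. vector [a * x$1, b * x$2]) \<in> signed_perms"
  unfolding signed_perms_def by blast

lemma signed_perms_swap: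
  "a \<in> {1, -1} \<Longrightarrow> b \<in> {1, -1} \<Longrightarrow> (\<lambda>x. vector [a * x$2, b * x$1]) \<in> signed_perms"
  unfolding signed_perms_def by blast

lemma signed_perms_cases:
  assumes "f \<in> signed_perms"
  obtains (diag) a b where "a \<in> {1, -1}" "b \<in> {1, -1}" "f = (\<lambda>x. vector [a * x$1, b * x$2])"
  | (swap) a b where "a \<in> {1, -1}" "b \<in> {1, -1}" "f = (\<lambda>x. vector [a * x$2, b * x$1])"
  using assms unfolding signed_perms_def by blast

lemma signed_perms_comp:
  assumes "f \<in> signed_perms" "g \<in> signed_perms"
  shows "f \<circ> g \<in> signed_perms"
proof -
  have *: "a * b \<in> {1, -1}" if "a \<in> {1, -1}" "b \<in> {1, -1}" for a b :: real
    using that by auto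
  show ?thesis
    using assms(1)
  proof (cases rule: signed_perms_cases)
    case f: (diag a b)
    show ?thesis
      using assms(2)
    proof (cases rule: signed_perms_cases)
      case (diag c d)
      then show ?thesis
        using signed_perms_diag[of "a * c" "b * d"] f * by (simp add: o_def mult.assoc)
    next
      case (swap c d)
      then show ?thesis
        using signed_perms_swap[of "a * c" "b * d"] f * by (simp add: o_def mult.assoc)
    qed
  next
    case f: (swap a b)
    show ?thesis
      using assms(2)
    proof (cases rule: signed_perms_cases)
      case (diag c d)
      then show ?thesis
        using signed_perms_swap[of "a * d" "b * c"] f * by (simp add: o_def mult.assoc)
    next
      case (swap c d)
      then show ?thesis
        using signed_perms_diag[of "a * d" "b * c"] f * by (simp add: o_def mult.assoc)
    qed
  qed
qed

lemma vec2_eq_iff: "(x::real^2) = y \<longleftrightarrow> x$1 = y$1 \<and> x$2 = y$2"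
  by (simp add: vec_eq_iff forall_2)

lemma reflection_unit:
  "reflection (vector [cos \<theta>, sin \<theta>]) =
     (\<lambda>x. vector [- cos (2 * \<theta>) * x$1 - sin (2 * \<theta>) * x$2, - sin (2 * \<theta>) * x$1 + cos (2 * \<theta>) * x$2])"
proof
  fix x :: "real^2"
  have n: "(vector [cos \<theta>, sin \<theta>] :: real^2) \<bullet> vector [cos \<theta>, sin \<theta>] = 1"
    by (simp add: inner_vec_def sum_2 power2_eq_square[symmetric])
  have c: "cos (2 * \<theta>) = 2 * cos \<theta> * cos \<theta> - 1"
    by (simp add: cos_double_cos power2_eq_square)
  have c': "cos (2 * \<theta>) = 1 - 2 * sin \<theta> * sin \<theta>"
    by (simp add: cos_double_sin power2_eq_square)
  have 1: "reflection (vector [cos \<theta>, sin \<theta>]) x $ 1 = - cos (2 * \<theta>) * x$1 - sin (2 * \<theta>) * x$2"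
    unfolding sin_double c reflection_def n by (simp add: inner_vec_def sum_2 algebra_simps)
  have 2: "reflection (vector [cos \<theta>, sin \<theta>]) x $ 2 = - sin (2 * \<theta>) * x$1 + cos (2 * \<theta>) * x$2"
    unfolding sin_double c' reflection_def n by (simp add: inner_vec_def sum_2 algebra_simps)
  show "reflection (vector [cos \<theta>, sin \<theta>]) x =
     vector [- cos (2 * \<theta>) * x$1 - sin (2 * \<theta>) * x$2, - sin (2 * \<theta>) * x$1 + cos (2 * \<theta>) * x$2]"
    using 1 2 by (simp add: vec2_eq_iff)
qed

lemma cos_sin_quarter_turns:
  "cos (pi * 2 / 2) = -1" "sin (pi * 2 / 2) = 0"
  "cos (pi * 3 / 2) = 0" "sin (pi * 3 / 2) = -1"
proof -
  have e: "pi * 3 / 2 = pi / 2 + pi"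
    by simp
  show "cos (pi * 3 / 2) = 0" "sin (pi * 3 / 2) = -1"
    unfolding e cos_periodic_pi sin_periodic_pi by simp_all
qed simp_all

lemma reflections_I2_4:
  "reflection ` I2_4 =
     {\<lambda>x. vector [-1 * x$1, 1 * x$2], \<lambda>x. vector [-1 * x$2, -1 * x$1],
      \<lambda>x. vector [1 * x$1, -1 * x$2], \<lambda>x. vector [1 * x$2, 1 * x$1]}"
    (is "_ = ?R")
proof -
  define r where "r j = reflection (vector [cos (pi * real j / 4), sin (pi * real j / 4)])" for j :: nat
  have r: "r j = (\<lambda>x. vector [- cos (pi * real j / 2) * x$1 - sin (pi * real j / 2) * x$2,
      - sin (pi * real j / 2) * x$1 + cos (pi * real j / 2) * x$2])" for j
    unfolding r_def reflection_unit by simp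
  have per: "r (j + 4) = r j" for j
  proof -
    have "pi * real (j + 4) / 2 = pi * real j / 2 + 2 * pi"
      by (simp add: field_simps)
    then show ?thesis
      by (simp only: r cos_periodic sin_periodic)
  qed
  have r0: "r 0 = (\<lambda>x. vector [-1 * x$1, 1 * x$2])"
    by (simp add: r)
  have r1: "r 1 = (\<lambda>x. vector [-1 * x$2, -1 * x$1])"
    by (simp add: r)
  have r2: "r 2 = (\<lambda>x. vector [1 * x$1, -1 * x$2])"
    by (simp add: r)
  have r3: "r 3 = (\<lambda>x. vector [1 * x$2, 1 * x$1])"
    using cos_sin_quarter_turns by (simp add: r)
  have "reflection ` I2_4 = r ` {0..7}"
    unfolding I2_4_def r_def by blast
  also have "{0..7} = {0, 1, 2, 3, 0 + 4, 1 + 4, 2 + 4, 3 + 4 :: nat}"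
    by auto
  also have "r ` \<dots> = {r 0, r 1, r 2, r 3}"
    by (simp only: image_insert image_empty per) blast
  finally show ?thesis
    by (simp only: r0 r1 r2 r3)
qed

lemma reflections_subset: "reflection ` I2_4 \<subseteq> signed_perms"
  unfolding reflections_I2_4
  by (simp only: insert_subset empty_subsetI signed_perms_diag signed_perms_swap insert_iff simp_thms)

lemma reflection_involutive:
  assumes "h \<in> reflection ` I2_4"
  shows "h \<circ> h = id"
  using assms unfolding reflections_I2_4 by (auto simp: fun_eq_iff vec2_eq_iff)

lemma BijGroup_UNIV:
  "carrier (BijGroup UNIV) = {f. bij f}" "\<one>\<^bsub>BijGroup UNIV\<^esub> = id"
  "\<And>f g. bij f \<Longrightarrow> bij g \<Longrightarrow> f \<otimes>\<^bsub>BijGroup UNIV\<^esub> g = f \<circ> g"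
  by (auto simp: BijGroup_def Bij_def compose_def fun_eq_iff)

lemma reflection_bij: "h \<in> reflection ` I2_4 \<Longrightarrow> bij h"
  using reflection_involutive o_bij by blast

lemma generate_reflections_bij: "g \<in> weyl_group_I2_4 \<Longrightarrow> bij g"
  using group.generate_in_carrier[OF group_BijGroup, of "reflection ` I2_4" UNIV g]
    reflection_bij BijGroup_UNIV(1) unfolding weyl_group_I2_4_def by blast

lemma weyl_group_comp:
  assumes "f \<in> weyl_group_I2_4" "g \<in> weyl_group_I2_4"
  shows "f \<circ> g \<in> weyl_group_I2_4"
  using generate.eng[OF assms[unfolded weyl_group_I2_4_def]]
    BijGroup_UNIV(3)[OF assms[THEN generate_reflections_bij]]
  unfolding weyl_group_I2_4_def by simp

lemma weyl_group_reflection: "h \<in> reflection ` I2_4 \<Longrightarrow> h \<in> weyl_group_I2_4"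
  unfolding weyl_group_I2_4_def by (rule generate.incl)

lemma weyl_group_I2_4_eq: "weyl_group_I2_4 = signed_perms"
proof
  show "weyl_group_I2_4 \<subseteq> signed_perms"
  proof
    fix g assume "g \<in> weyl_group_I2_4"
    then have "g \<in> generate (BijGroup UNIV) (reflection ` I2_4)"
      unfolding weyl_group_I2_4_def .
    then show "g \<in> signed_perms"
    proof (induction rule: generate.induct)
      case one
      have "id = (\<lambda>x::real^2. vector [1 * x$1, 1 * x$2])"
        by (simp add: fun_eq_iff vec2_eq_iff)
      then show ?case
        using signed_perms_diag[of 1 1] by (simp only: BijGroup_UNIV(2) insert_iff simp_thms)
    next
      case (incl h)
      then show ?case
        using reflections_subset by blast
    next
      case (inv h)
      have "inv\<^bsub>BijGroup UNIV\<^esub> h = h"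
        using inv reflection_bij[OF inv] reflection_involutive[OF inv]
        by (intro group.inv_equality group_BijGroup) (simp_all add: BijGroup_UNIV)
      then show ?case
        using inv reflections_subset by auto
    next
      case (eng f g)
      then have "bij f" "bij g"
        using generate_reflections_bij unfolding weyl_group_I2_4_def by blast+
      then show ?case
        using signed_perms_comp[OF eng.IH] by (simp only: BijGroup_UNIV(3))
    qed
  qed
  have s0: "(\<lambda>x. vector [-1 * x$1, 1 * x$2]) \<in> weyl_group_I2_4"
    and s1: "(\<lambda>x. vector [-1 * x$2, -1 * x$1]) \<in> weyl_group_I2_4"
    and s2: "(\<lambda>x. vector [1 * x$1, -1 * x$2]) \<in> weyl_group_I2_4"
    and s3: "(\<lambda>x. vector [1 * x$2, 1 * x$1]) \<in> weyl_group_I2_4"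
    by (rule weyl_group_reflection, simp only: reflections_I2_4, blast)+
  have m: "(\<lambda>x. vector [-1 * x$1, -1 * x$2]) \<in> weyl_group_I2_4"
    using weyl_group_comp[OF s0 s2] by (simp add: o_def)
  have i: "(\<lambda>x. vector [1 * x$1, 1 * x$2]) \<in> weyl_group_I2_4"
    using weyl_group_comp[OF s3 s3] by (simp add: o_def)
  have p: "(\<lambda>x. vector [-1 * x$2, 1 * x$1]) \<in> weyl_group_I2_4"
    using weyl_group_comp[OF s0 s3] by (simp add: o_def)
  have q: "(\<lambda>x. vector [1 * x$2, -1 * x$1]) \<in> weyl_group_I2_4"
    using weyl_group_comp[OF s2 s3] by (simp add: o_def)
  show "signed_perms \<subseteq> weyl_group_I2_4"
  proof
    fix f assume "f \<in> signed_perms"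
    then show "f \<in> weyl_group_I2_4"
    proof (cases rule: signed_perms_cases)
      case (diag a b)
      then show ?thesis
        using i s0 s2 m by (elim insertE emptyE) (simp_all only:)
    next
      case (swap a b)
      then show ?thesis
        using p q s1 s3 by (elim insertE emptyE) (simp_all only:)
    qed
  qed
qed

lemma finite_weyl_group_I2_4: "finite weyl_group_I2_4"
proof -
  have *: "signed_perms =
     (\<lambda>(a, b) x. vector [a * x$1, b * x$2]) ` ({1, -1} \<times> {1, -1}) \<union>
     (\<lambda>(a, b) x. vector [a * x$2, b * x$1]) ` ({1, -1} \<times> {1, -1})"
    unfolding signed_perms_def by fast
  show ?thesis
    unfolding weyl_group_I2_4_eq * by (intro finite_UnI finite_imageI finite_SigmaI) simp_all
qed

end

theory Submission
  imports Defs
begin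

text \<open>
  Expanding \<open>\<parallel>g x - y\<parallel>\<^sup>2\<close> and summing over the eight signed permutations gives
  \<open>2 (cosh A - cosh B - cosh C + cosh E)\<close> times a Gaussian prefactor, where
  \<open>A\<close>, \<open>B\<close> are \<open>(x\<^sub>1 y\<^sub>1 + x\<^sub>2 y\<^sub>2) / 2 t\<close>, \<open>(x\<^sub>1 y\<^sub>2 + x\<^sub>2 y\<^sub>1) / 2 t\<close> and
  \<open>C\<close>, \<open>E\<close> are the corresponding absolute differences (\<open>heat_kernel_det_I2_4_eq\<close>). The same prefactor
  times \<open>exp A\<close> is the free kernel at \<open>x - y\<close>, so the task is to compare this combination of
  four hyperbolic cosines with \<open>exp A\<close>.

  The cancellation becomes visible through the identity \<open>A\<^sup>2 + E\<^sup>2 = B\<^sup>2 + C\<^sup>2\<close>: both sides are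
  \<open>\<parallel>x\<parallel>\<^sup>2 \<parallel>y\<parallel>\<^sup>2 / 4 t\<^sup>2\<close>. Hence \<open>A\<^sup>2\<close>, \<open>B\<^sup>2\<close>, \<open>C\<^sup>2\<close>, \<open>E\<^sup>2\<close> have the form
  \<open>s + p + q\<close>, \<open>s + q\<close>, \<open>s + p\<close>, \<open>s\<close>, and the combination is a mixed second
  difference of \<open>\<phi>(s) = cosh (sqrt s)\<close>. Applying the mean value theorem twice turns it into
  \<open>p q \<phi>''(\<eta>)\<close> (\<open>cosh_sqrt_mixed_difference\<close>). Here \<open>p = (A - B) (A + B)\<close> and
  \<open>q = (A - C) (A + C)\<close>, and these four linear factors are, up to powers of 2, the four
  products in the theorem divided by \<open>t\<close>.

  Two-sided bounds \<open>\<phi>''(s) \<simeq> exp r / (1 + r)\<^sup>2\<close> with \<open>r = sqrt s\<close>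
  (\<open>cosh_sqrt_deriv2_bounds\<close>) then finish the proof. For the lower bound, the rectangle with
  sides \<open>p\<close>, \<open>q\<close> is first shrunk to sides at most \<open>A\<close>, keeping the corner \<open>A\<^sup>2\<close>; this only
  decreases the difference, as \<open>\<phi>'' \<ge> 0\<close>, and it confines \<open>sqrt \<eta>\<close> to \<open>[A - 2, A]\<close>. For the
  upper bound, \<open>\<phi>''(\<eta>)\<close> is at most a multiple of \<open>exp A / (1 + A)\<^sup>2\<close>, which suffices when
  \<open>A - B\<close> and \<open>A - C\<close> are at most 1; otherwise the estimates of \<open>cosh A - cosh B\<close> and
  \<open>cosh A - cosh C\<close> suffice.
\<close>

section \<open>Mixed second differences\<close>

text \<open>
  The left-hand side is the increment of \<open>f (v + p) - f v\<close> from \<open>s\<close> to \<open>s + q\<close>; one mean value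
  theorem gives the increment of \<open>f'\<close> over an interval of length \<open>p\<close>, and another one gives
  \<open>f''\<close>. Differentiability is assumed in the open interval only, because \<open>cosh (sqrt s)\<close> will
  be used from the end point \<open>s = 0\<close> on, where \<open>sqrt\<close> is not differentiable.
\<close>

lemma mixed_difference_mean_value:
  fixes f f' f'' :: "real \<Rightarrow> real"
  assumes "0 < p" "0 < q"
    and cont: "continuous_on {s..s + p + q} f"
    and der: "\<And>z. s < z \<Longrightarrow> z < s + p + q \<Longrightarrow> (f has_real_derivative f' z) (at z)"
    and der2: "\<And>z. s < z \<Longrightarrow> z < s + p + q \<Longrightarrow> (f' has_real_derivative f'' z) (at z)"
  shows "\<exists>\<eta>. s < \<eta> \<and> \<eta> < s + p + q \<and> f (s + p + q) - f (s + p) - f (s + q) + f s = p * q * f'' \<eta>"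
proof -
  define G where "G v = f (v + p) - f v" for v
  have G': "(G has_real_derivative f' (z + p) - f' z) (at z)" if "s < z" "z < s + q" for z
    unfolding G_def using that assms(1,2)
    by (intro DERIV_diff der) (auto intro!: DERIV_shift[THEN iffD1] der)
  have "continuous_on {s..s + q} G"
    unfolding G_def
    by (intro continuous_on_diff continuous_on_compose2[OF cont] continuous_intros
        continuous_on_subset[OF cont]) (use assms(1,2) in auto)
  then obtain l \<xi> where \<xi>: "s < \<xi>" "\<xi> < s + q" "(G has_real_derivative l) (at \<xi>)"
      "G (s + q) - G s = (s + q - s) * l"
    using MVT[of s "s + q" G] G' assms(2) real_differentiable_def by (metis less_add_same_cancel1)
  have l: "l = f' (\<xi> + p) - f' \<xi>"
    using DERIV_unique[OF \<xi>(3) G'[OF \<xi>(1,2)]] .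
  obtain \<eta> where "\<xi> < \<eta>" "\<eta> < \<xi> + p" "f' (\<xi> + p) - f' \<xi> = (\<xi> + p - \<xi>) * f'' \<eta>"
    using MVT2[of \<xi> "\<xi> + p" f' f''] der2 \<xi>(1,2) assms(1) by force
  with \<xi> l show ?thesis
    by (intro exI[of _ \<eta>]) (auto simp: G_def algebra_simps)
qed

section \<open>The second derivative of \<open>cosh (sqrt s)\<close>\<close>

definition cosh_sqrt_deriv2 :: "real \<Rightarrow> real" where
  "cosh_sqrt_deriv2 s = (sqrt s * cosh (sqrt s) - sinh (sqrt s)) / (4 * sqrt s ^ 3)"

lemma cosh_sqrt_has_deriv:
  assumes "0 < s"
  shows "((\<lambda>s. cosh (sqrt s)) has_real_derivative sinh (sqrt s) / (2 * sqrt s)) (at s)"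
  using assms by (auto intro!: derivative_eq_intros simp: field_simps)

lemma cosh_sqrt_has_deriv2:
  assumes "0 < s"
  shows "((\<lambda>s. sinh (sqrt s) / (2 * sqrt s)) has_real_derivative cosh_sqrt_deriv2 s) (at s)"
proof -
  define r where "r = sqrt s"
  have r: "r > 0" "s = r^2" using assms by (auto simp: r_def)
  show ?thesis
    using assms r(1)
    apply (auto intro!: derivative_eq_intros simp: cosh_sqrt_deriv2_def r_def[symmetric])
    by (auto simp: field_simps power2_eq_square power3_eq_cube)
qed

text \<open>
  Both bounds have the form \<open>r exp r / (1 + r)\<close>, which captures the linear behaviour near 0 and
  the exponential growth at infinity at once.
\<close>

lemma sinh_bounds:
  fixes r :: real
  assumes "0 \<le> r"
  shows "r * exp r / (2 * (1 + r)) \<le> sinh r" "sinh r \<le> 2 * r * exp r / (1 + r)"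
proof -
  have s: "sinh r = exp r * (1 - exp (- (2 * r))) / 2"
    by (simp add: sinh_field_def algebra_simps flip: exp_add)
  have "exp (- (2 * r)) \<le> inverse (1 + 2 * r)"
    unfolding exp_minus using assms by (intro le_imp_inverse_le exp_ge_add_one_self) auto
  then have "1 - exp (- (2 * r)) \<ge> r / (1 + r)"
    using assms by (rule_tac order_trans[rotated, of "1 - inverse (1 + 2 * r)"]) (auto simp: field_simps)
  from mult_left_mono[OF this, of "exp r / 2"]
  show "r * exp r / (2 * (1 + r)) \<le> sinh r"
    by (simp add: s field_simps)
  have "1 - exp (- (2 * r)) \<le> min 1 (2 * r)"
    using exp_ge_add_one_self[of "- (2 * r)"] by auto
  also have "\<dots> \<le> 4 * r / (1 + r)"
    using assms mult_left_mono[of r 1 r] by (auto simp: min_def field_simps)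
  finally show "sinh r \<le> 2 * r * exp r / (1 + r)"
    using mult_left_mono[of "1 - exp (- (2 * r))" "4 * r / (1 + r)" "exp r / 2"] by (simp add: s field_simps)
qed

text \<open>
  The bounds and the function between them vanish at 0, so it is enough to compare derivatives. The derivative of
  \<open>r cosh r - sinh r\<close> is \<open>r sinh r\<close>, where no cancellation is left and \<open>sinh_bounds\<close> applies.
\<close>

lemma mult_cosh_minus_sinh_bounds:
  fixes r :: real
  assumes "0 \<le> r"
  defines "g \<equiv> \<lambda>r::real. r ^ 3 * exp r / (1 + r)\<^sup>2"
  shows "g r / 6 \<le> r * cosh r - sinh r" "r * cosh r - sinh r \<le> 2 * g r"
proof -
  define g' where "g' = (\<lambda>z::real. exp z * z^2 * (3 + z - 2 * z / (1 + z)) / (1 + z)^2)"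
  have g: "(g has_real_derivative g' z) (at z)" if "0 \<le> z" for z
  proof -
    have "1 + z \<noteq> 0" using that by auto
    then show ?thesis
      unfolding g_def g'_def
      by (auto intro!: derivative_eq_intros simp: divide_simps) algebra
  qed
  have h: "((\<lambda>r. r * cosh r - sinh r) has_real_derivative z * sinh z) (at z)" for z :: real
    by (auto intro!: derivative_eq_intros)
  have up: "g' z \<le> 6 * (z * sinh z)" if "0 \<le> z" for z
  proof -
    have "0 \<le> 2 * z / (1 + z)"
      using that by simp
    then have "3 + z - 2 * z / (1 + z) \<le> 3 * (1 + z)"
      using that by argo
    then have "g' z \<le> exp z * z^2 * (3 * (1 + z)) / (1 + z)^2"
      unfolding g'_def by (intro divide_right_mono mult_left_mono) auto
    also have "\<dots> = 6 * (z * (z * exp z / (2 * (1 + z))))"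
    proof -
      have "exp z * z^2 * (3 * w) / w^2 = 6 * (z * (z * exp z / (2 * w)))" if "w \<noteq> 0" for w
        using that by (simp add: power2_eq_square)
      from this[of "1 + z"] show ?thesis using that by argo
    qed
    also have "\<dots> \<le> 6 * (z * sinh z)"
      using sinh_bounds[OF that] that by (intro mult_left_mono) auto
    finally show ?thesis .
  qed
  have low: "z * sinh z \<le> 2 * g' z" if "0 \<le> z" for z
  proof -
    have "z * sinh z \<le> z * (2 * z * exp z / (1 + z))"
      using sinh_bounds[OF that] that by (intro mult_left_mono) auto
    also have "\<dots> = 2 * (exp z * z^2 * (1 + z) / (1 + z)^2)"
      using that by (simp add: power2_eq_square)
    also have "\<dots> \<le> 2 * g' z"
    proof -
      have "2 * z / (1 + z) \<le> 2"
        using that by (simp add: divide_simps)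
      then have "1 + z \<le> 3 + z - 2 * z / (1 + z)"
        by linarith
      then show ?thesis
        unfolding g'_def by (intro mult_left_mono divide_right_mono) auto
    qed
    finally show ?thesis .
  qed
  have "(\<lambda>r. (r * cosh r - sinh r) - g r / 6) 0 \<le> (\<lambda>r. (r * cosh r - sinh r) - g r / 6) r"
  proof (rule DERIV_nonneg_imp_nondecreasing[OF assms(1)])
    fix z :: real assume "0 \<le> z"
    then show "\<exists>y. ((\<lambda>r. (r * cosh r - sinh r) - g r / 6) has_real_derivative y) (at z) \<and> 0 \<le> y"
      using up[of z] by (intro exI[of _ "z * sinh z - g' z / 6"] conjI DERIV_diff h DERIV_cdivide g) simp_all
  qed
  then show "g r / 6 \<le> r * cosh r - sinh r" by (simp add: g_def)
  have "(\<lambda>r. 2 * g r - (r * cosh r - sinh r)) 0 \<le> (\<lambda>r. 2 * g r - (r * cosh r - sinh r)) r"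
  proof (rule DERIV_nonneg_imp_nondecreasing[OF assms(1)])
    fix z :: real assume "0 \<le> z"
    then show "\<exists>y. ((\<lambda>r. 2 * g r - (r * cosh r - sinh r)) has_real_derivative y) (at z) \<and> 0 \<le> y"
      using low[of z] by (intro exI[of _ "2 * g' z - z * sinh z"] conjI DERIV_diff h DERIV_cmult g) simp_all
  qed
  then show "r * cosh r - sinh r \<le> 2 * g r" by (simp add: g_def)
qed

lemma cosh_sqrt_deriv2_bounds:
  assumes "0 < s"
  shows "exp (sqrt s) / (24 * (1 + sqrt s)\<^sup>2) \<le> cosh_sqrt_deriv2 s"
    and "cosh_sqrt_deriv2 s \<le> exp (sqrt s) / (2 * (1 + sqrt s)\<^sup>2)"
proof -
  define r where "r = sqrt s"
  have r: "0 < r" using assms by (simp add: r_def)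
  have "exp r / (24 * (1 + r)\<^sup>2) = (r ^ 3 * exp r / (1 + r)\<^sup>2 / 6) / (4 * r ^ 3)"
    using r by (simp add: field_simps)
  also have "\<dots> \<le> (r * cosh r - sinh r) / (4 * r ^ 3)"
    using mult_cosh_minus_sinh_bounds[of r] r by (intro divide_right_mono) auto
  finally show "exp (sqrt s) / (24 * (1 + sqrt s)\<^sup>2) \<le> cosh_sqrt_deriv2 s"
    by (simp add: cosh_sqrt_deriv2_def r_def)
  have "(r * cosh r - sinh r) / (4 * r ^ 3) \<le> (2 * (r ^ 3 * exp r / (1 + r)\<^sup>2)) / (4 * r ^ 3)"
    using mult_cosh_minus_sinh_bounds[of r] r by (intro divide_right_mono) auto
  also have "\<dots> = exp r / (2 * (1 + r)\<^sup>2)"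
    using r by (simp add: field_simps)
  finally show "cosh_sqrt_deriv2 s \<le> exp (sqrt s) / (2 * (1 + sqrt s)\<^sup>2)"
    by (simp add: cosh_sqrt_deriv2_def r_def)
qed

lemma cosh_sqrt_mixed_difference:
  assumes "0 \<le> s" "0 < p" "0 < q"
  shows "\<exists>\<eta>. s < \<eta> \<and> \<eta> < s + p + q \<and>
    cosh (sqrt (s + p + q)) - cosh (sqrt (s + p)) - cosh (sqrt (s + q)) + cosh (sqrt s)
      = p * q * cosh_sqrt_deriv2 \<eta>"
proof (rule mixed_difference_mean_value[OF assms(2,3)])
  show "continuous_on {s..s + p + q} (\<lambda>s. cosh (sqrt s))"
    by (intro continuous_intros)
qed (use assms(1) in \<open>auto intro!: cosh_sqrt_has_deriv cosh_sqrt_has_deriv2\<close>)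

lemma cosh_sqrt_mixed_difference_nonneg:
  assumes "0 \<le> s" "0 \<le> p" "0 \<le> q"
  shows "0 \<le> cosh (sqrt (s + p + q)) - cosh (sqrt (s + p)) - cosh (sqrt (s + q)) + cosh (sqrt s)"
proof (cases "p = 0 \<or> q = 0")
  case False
  with assms have "0 < p" "0 < q" by auto
  from cosh_sqrt_mixed_difference[OF assms(1) this] obtain \<eta> where
    "s < \<eta>" "cosh (sqrt (s + p + q)) - cosh (sqrt (s + p)) - cosh (sqrt (s + q)) + cosh (sqrt s)
      = p * q * cosh_sqrt_deriv2 \<eta>" by blast
  moreover have "0 \<le> cosh_sqrt_deriv2 \<eta>"
    using \<open>s < \<eta>\<close> assms(1) by (intro order_trans[OF _ cosh_sqrt_deriv2_bounds(1)]) auto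
  ultimately show ?thesis using assms by simp
qed auto

text \<open>
  Here \<open>p'\<close>, \<open>q'\<close> are the sides of a smaller rectangle with the same upper corner
  \<open>s + p + q\<close>. Mixed differences are additive over subdivisions into rectangles, and the part
  that is removed consists of two rectangles, each contributing a nonnegative amount.
\<close>

lemma cosh_sqrt_mixed_difference_mono:
  assumes "0 \<le> s" "0 \<le> p'" "p' \<le> p" "0 \<le> q'" "q' \<le> q"
  shows "cosh (sqrt (s + p + q)) - cosh (sqrt (s + p + q - q')) - cosh (sqrt (s + p + q - p'))
           + cosh (sqrt (s + p + q - p' - q'))
      \<le> cosh (sqrt (s + p + q)) - cosh (sqrt (s + p)) - cosh (sqrt (s + q)) + cosh (sqrt s)"
proof -
  have 1: "0 \<le> cosh (sqrt (s + (p - p') + q)) - cosh (sqrt (s + (p - p'))) - cosh (sqrt (s + q)) + cosh (sqrt s)"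
    using assms by (intro cosh_sqrt_mixed_difference_nonneg) auto
  have 2: "0 \<le> cosh (sqrt ((s + (p - p')) + p' + (q - q'))) - cosh (sqrt ((s + (p - p')) + p'))
      - cosh (sqrt ((s + (p - p')) + (q - q'))) + cosh (sqrt (s + (p - p')))"
    using assms by (intro cosh_sqrt_mixed_difference_nonneg) auto
  from 1 2 show ?thesis by (simp add: algebra_simps)
qed

section \<open>Four hyperbolic cosines\<close>

definition saturation :: "real \<Rightarrow> real" where
  "saturation m = m / (1 + m)"

lemma saturation_bounds:
  assumes "0 \<le> m"
  shows "0 \<le> saturation m" "saturation m \<le> min 1 m" "min 1 m \<le> 2 * saturation m"
proof -
  show "0 \<le> saturation m" "saturation m \<le> min 1 m"
    using assms by (auto simp: saturation_def field_simps)
  show "min 1 m \<le> 2 * saturation m"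
    using assms mult_left_mono[of m 1 m] by (auto simp: saturation_def min_def field_simps)
qed

lemma saturation_mono:
  assumes "0 \<le> m" "m \<le> n"
  shows "saturation m \<le> saturation n"
  using assms by (auto simp: saturation_def field_simps)

lemma saturation_scale:
  assumes "0 \<le> m" "1 \<le> c"
  shows "saturation (c * m) \<le> c * saturation m"
proof -
  have "c * m / (1 + c * m) \<le> c * m / (1 + m)"
    using assms mult_right_mono[of 1 c m] by (intro divide_left_mono) (auto intro!: add_pos_nonneg)
  then show ?thesis by (simp add: saturation_def)
qed

lemma cosh_diff_le:
  fixes a b :: real
  assumes "0 \<le> b" "b \<le> a"
  shows "cosh a - cosh b \<le> min 1 (a - b) * exp a"
proof -
  have "cosh a \<le> exp a"
    using assms by (simp add: cosh_def)
  then have "cosh a - cosh b \<le> exp a"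
    using cosh_real_nonneg[of b] by linarith
  moreover have "cosh a - cosh b \<le> (a - b) * exp a"
  proof (cases "a = b")
    case False
    then have "b < a" using assms by simp
    then obtain z where z: "b < z" "z < a" "cosh a - cosh b = (a - b) * sinh z"
      using MVT2[of b a cosh sinh] has_field_derivative_cosh[OF DERIV_ident] by auto
    have "sinh z \<le> exp z"
      by (simp add: sinh_def) (rule order_trans[of _ 0], simp_all)
    also have "\<dots> \<le> exp a" using z(2) by simp
    finally have "sinh z \<le> exp a" .
    with z assms show ?thesis by (simp add: mult_left_mono)
  qed simp
  ultimately show ?thesis
    by (cases "1 \<le> a - b") (simp_all add: min_def)
qed

text \<open>
  The hypothesis on the squares says that \<open>E\<^sup>2\<close>, \<open>B\<^sup>2\<close>, \<open>C\<^sup>2\<close>, \<open>A\<^sup>2\<close> are the values of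
  \<open>s + u + v\<close> at the corners of a rectangle with one corner \<open>(0, 0)\<close>, so that the combination below is a mixed
  second difference of \<open>cosh (sqrt s)\<close>.
\<close>

locale cosh_rectangle =
  fixes A B C E :: real
  assumes B: "0 \<le> B" "B < A" and C: "0 \<le> C" "C < A" and E: "0 \<le> E"
    and parallelogram: "A\<^sup>2 + E\<^sup>2 = B\<^sup>2 + C\<^sup>2"
begin

abbreviation "difference \<equiv> cosh A - cosh B - cosh C + cosh E"

abbreviation "profile \<equiv> (saturation A)\<^sup>2 * saturation (A - B) * saturation (A - C) * exp A"

definition "p = A\<^sup>2 - B\<^sup>2"
definition "q = A\<^sup>2 - C\<^sup>2"

lemma A_pos: "0 < A" using B by simp

lemma p_eq: "p = (A - B) * (A + B)" and q_eq: "q = (A - C) * (A + C)"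
  by (auto simp: p_def q_def power2_eq_square algebra_simps)

lemma pq_pos: "0 < p" "0 < q"
  using B C by (auto simp: p_eq q_eq)

lemma sqrts: "sqrt (E\<^sup>2 + p + q) = A" "sqrt (E\<^sup>2 + p) = C" "sqrt (E\<^sup>2 + q) = B" "sqrt (E\<^sup>2) = E"
proof -
  have "E\<^sup>2 + p + q = A\<^sup>2" "E\<^sup>2 + p = C\<^sup>2" "E\<^sup>2 + q = B\<^sup>2"
    using parallelogram by (auto simp: p_def q_def)
  then show "sqrt (E\<^sup>2 + p + q) = A" "sqrt (E\<^sup>2 + p) = C" "sqrt (E\<^sup>2 + q) = B" "sqrt (E\<^sup>2) = E"
    using A_pos B C E by auto
qed

text \<open>
  The intermediate point for the full rectangle may lie far below \<open>A\<^sup>2\<close>, where the second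
  derivative is exponentially smaller. With sides cut down to at most \<open>A\<close>, its square root is
  within 2 of \<open>A\<close>, at the cost of a factor \<open>exp (- 2)\<close>; the sides remain at least \<open>A\<close> times the
  saturated gaps.
\<close>

lemma profile_le_difference: "exp (- 2) / 24 * profile \<le> difference"
proof -
  define p' where "p' = min p A"
  define q' where "q' = min q A"
  have p': "0 < p'" "p' \<le> p" "p' \<le> A" and q': "0 < q'" "q' \<le> q" "q' \<le> A"
    using pq_pos A_pos by (auto simp: p'_def q'_def)
  define s where "s = E\<^sup>2 + p + q - p' - q'"
  have s: "0 \<le> s" using p' q' zero_le_power2[of E] unfolding s_def by linarith
  have A2: "E\<^sup>2 + p + q = A\<^sup>2"
    using parallelogram by (auto simp: p_def q_def)
  obtain \<eta> where \<eta>: "s < \<eta>" "\<eta> < s + p' + q'"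
    "cosh (sqrt (s + p' + q')) - cosh (sqrt (s + p')) - cosh (sqrt (s + q')) + cosh (sqrt s)
      = p' * q' * cosh_sqrt_deriv2 \<eta>"
    using cosh_sqrt_mixed_difference[OF s p'(1) q'(1)] by blast
  have corners: "s + p' + q' = E\<^sup>2 + p + q" "s + p' = E\<^sup>2 + p + q - q'" "s + q' = E\<^sup>2 + p + q - p'"
    by (simp_all add: s_def)
  have le: "p' * q' * cosh_sqrt_deriv2 \<eta> \<le> difference"
    using cosh_sqrt_mixed_difference_mono[of "E\<^sup>2" p' p q' q] p' q' \<eta>(3)
    unfolding corners s_def[symmetric] by (simp add: sqrts)
  have "sqrt \<eta> \<le> A"
    using \<eta>(2) A2 A_pos by (intro real_le_lsqrt) (auto simp: s_def)
  have "A - 2 \<le> sqrt \<eta>"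
  proof (cases "A \<le> 2")
    case True
    then show ?thesis using s \<eta>(1) by (smt (verit) real_sqrt_ge_zero)
  next
    case False
    have "(A - 2)\<^sup>2 \<le> A\<^sup>2 - 2 * A"
      using False by (simp add: power2_eq_square algebra_simps)
    also have "\<dots> \<le> \<eta>"
      using \<eta>(1) p' q' A2 by (simp add: s_def)
    finally show ?thesis by (rule real_le_rsqrt)
  qed
  have "exp (- 2) / 24 * (exp A / (1 + A)\<^sup>2) = exp (A - 2) / (24 * (1 + A)\<^sup>2)"
    by (simp add: exp_diff exp_minus field_simps)
  also have "\<dots> \<le> exp (sqrt \<eta>) / (24 * (1 + sqrt \<eta>)\<^sup>2)"
  proof -
    have pos: "0 < 1 + sqrt \<eta>"
      using \<eta>(1) s by (intro add_pos_nonneg) auto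
    then have "(1 + sqrt \<eta>)\<^sup>2 \<le> (1 + A)\<^sup>2"
      using \<open>sqrt \<eta> \<le> A\<close> by (intro power_mono) simp_all
    then show ?thesis
      using pos \<open>A - 2 \<le> sqrt \<eta>\<close> by (intro frac_le) simp_all
  qed
  also have "\<dots> \<le> cosh_sqrt_deriv2 \<eta>"
    using \<eta>(1) s by (intro cosh_sqrt_deriv2_bounds) auto
  finally have deriv: "exp (- 2) / 24 * (exp A / (1 + A)\<^sup>2) \<le> cosh_sqrt_deriv2 \<eta>" .
  have side: "A * saturation m \<le> min (m * (A + n)) A" if "0 < m" "0 \<le> n" for m n
  proof -
    have "A * saturation m \<le> A * min 1 m"
      using saturation_bounds[of m] that A_pos by (intro mult_left_mono) auto
    moreover have "A * m \<le> m * (A + n)"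
      using that by (simp add: algebra_simps)
    moreover have "A * min 1 m \<le> A * m" "A * min 1 m \<le> A * 1"
      using A_pos by (intro mult_left_mono; simp)+
    ultimately show ?thesis by simp
  qed
  have sides: "A * saturation (A - B) \<le> p'" "A * saturation (A - C) \<le> q'"
    using side[of "A - B" B] side[of "A - C" C] B C by (auto simp: p'_def q'_def p_eq q_eq)
  have "(A * saturation (A - B)) * (A * saturation (A - C)) * (exp (- 2) / 24 * (exp A / (1 + A)\<^sup>2))
      \<le> p' * q' * cosh_sqrt_deriv2 \<eta>"
  proof -
    have "0 \<le> A * saturation (A - B)" "0 \<le> A * saturation (A - C)"
      using A_pos B C by (simp_all add: saturation_bounds(1))
    then have "(A * saturation (A - B)) * (A * saturation (A - C)) \<le> p' * q'"
      using p'(1) by (intro mult_mono sides) linarith+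
    then show ?thesis
      by (rule mult_mono[OF _ deriv]) (use p'(1) q'(1) in simp_all)
  qed
  also note le
  finally show ?thesis
    by (simp add: saturation_def[of A] power2_eq_square mult_ac)
qed

text \<open>
  The intermediate point has \<open>sqrt \<eta> \<le> A\<close>, and \<open>exp r / (1 + r)\<^sup>2\<close> is increasing up to a
  factor 4.
\<close>

lemma difference_le_product: "difference \<le> 8 * (saturation A)\<^sup>2 * (A - B) * (A - C) * exp A"
proof -
  obtain \<eta> where \<eta>: "E\<^sup>2 < \<eta>" "\<eta> < E\<^sup>2 + p + q" "difference = p * q * cosh_sqrt_deriv2 \<eta>"
    using cosh_sqrt_mixed_difference[of "E\<^sup>2" p q] pq_pos by (auto simp: sqrts)
  define r where "r = sqrt \<eta>"
  have \<eta>0: "0 < \<eta>" using \<eta>(1) by (smt (verit) zero_le_power2)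
  have r: "0 < r" "r \<le> A"
    using \<eta>0 real_sqrt_less_mono[OF \<eta>(2)] by (simp_all add: r_def sqrts)
  (* Half of the gap in the exponent, because the estimate is squared afterwards. *)
  have "1 + A \<le> (1 + r) * (1 + (A - r))"
    using r mult_left_mono[of r A r] by (simp add: algebra_simps)
  also have "\<dots> \<le> (1 + r) * (2 * exp ((A - r) / 2))"
  proof (rule mult_left_mono)
    show "1 + (A - r) \<le> 2 * exp ((A - r) / 2)"
      using exp_ge_add_one_self[of "(A - r) / 2"] by argo
  qed (use r in simp)
  finally have "(1 + A)\<^sup>2 \<le> ((1 + r) * (2 * exp ((A - r) / 2)))\<^sup>2"
    using A_pos by (intro power_mono) auto
  also have "\<dots> = 4 * (1 + r)\<^sup>2 * (exp A / exp r)"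
  proof -
    have "(exp ((A - r) / 2))\<^sup>2 = exp A / exp r"
      by (simp flip: exp_double exp_diff)
    then show ?thesis by (simp add: power_mult_distrib)
  qed
  finally have decay: "exp r / (1 + r)\<^sup>2 \<le> 4 * exp A / (1 + A)\<^sup>2"
    using r A_pos by (simp add: field_simps)
  have deriv: "cosh_sqrt_deriv2 \<eta> \<le> 2 * exp A / (1 + A)\<^sup>2"
    using cosh_sqrt_deriv2_bounds(2)[OF \<eta>0] decay by (simp add: r_def)
  have "p \<le> (A - B) * (2 * A)" "q \<le> (A - C) * (2 * A)"
    using B C by (auto simp: p_eq q_eq)
  moreover have "0 \<le> cosh_sqrt_deriv2 \<eta>"
    using \<eta>0 by (intro order_trans[OF _ cosh_sqrt_deriv2_bounds(1)]) auto
  ultimately have "difference \<le> (A - B) * (2 * A) * ((A - C) * (2 * A)) * (2 * exp A / (1 + A)\<^sup>2)"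
    unfolding \<eta>(3) using deriv pq_pos B C A_pos by (intro mult_mono mult_nonneg_nonneg) auto
  also have "\<dots> = 8 * (saturation A)\<^sup>2 * (A - B) * (A - C) * exp A"
    by (simp add: saturation_def power_divide power2_eq_square[of A])
  finally show ?thesis .
qed

lemma E_le: "E \<le> B" "E \<le> C"
  using sqrts pq_pos by (smt (verit) real_sqrt_le_iff)+

text \<open>
  \<open>difference_le_product\<close> is sharp only while both gaps \<open>A - B\<close>, \<open>A - C\<close> are bounded. If one
  of them exceeds 1, then its own factor and that of \<open>A\<close> in the profile are at least \<open>1 / 2\<close>,
  and the difference of two hyperbolic cosines that have the other gap is already small enough.
\<close>

lemma difference_le_profile: "difference \<le> 32 * profile"
proof -
  have far: "x \<le> 32 * ((saturation A)\<^sup>2 * saturation m * saturation n * exp A)"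
    if "1 < m" "m \<le> A" "0 < n" "x \<le> min 1 n * exp A" for x m n
  proof -
    have "1 / 2 \<le> saturation m" "1 / 2 \<le> saturation A" "min 1 n \<le> 2 * saturation n" "0 \<le> saturation n"
      using saturation_bounds(3)[of m] saturation_bounds(3)[of A] saturation_bounds[of n] that by auto
    have "(1 / 2)\<^sup>2 \<le> (saturation A)\<^sup>2"
      using \<open>1 / 2 \<le> saturation A\<close> by (intro power_mono) simp_all
    then have "(1 / 2)\<^sup>2 * (1 / 2) \<le> (saturation A)\<^sup>2 * saturation m"
      using \<open>1 / 2 \<le> saturation m\<close> by (rule mult_mono) simp_all
    then have "(1 / 2)\<^sup>2 * (1 / 2) * saturation n * exp A
        \<le> (saturation A)\<^sup>2 * saturation m * saturation n * exp A"
      using \<open>0 \<le> saturation n\<close> by (intro mult_right_mono) simp_all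
    moreover have "x \<le> 2 * saturation n * exp A"
      using \<open>min 1 n \<le> 2 * saturation n\<close> that(4) by (smt (verit) mult_right_mono exp_ge_zero)
    moreover have "0 \<le> saturation n * exp A" using \<open>0 \<le> saturation n\<close> by simp
    ultimately show ?thesis by (simp add: power2_eq_square)
  qed
  have dB: "difference \<le> min 1 (A - B) * exp A" and dC: "difference \<le> min 1 (A - C) * exp A"
    using cosh_diff_le[of B A] cosh_diff_le[of C A] E_le B C E
      cosh_real_nonneg_le_iff[of E B] cosh_real_nonneg_le_iff[of E C] by linarith+
  consider "1 < A - B" | "1 < A - C" | "A - B \<le> 1" "A - C \<le> 1" by linarith
  then show ?thesis
  proof cases
    case 1
    then show ?thesis using far[OF _ _ _ dC, of "A - B"] B C by simp
  next
    case 2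
    then show ?thesis using far[OF _ _ _ dB, of "A - C"] B C by (simp add: mult_ac)
  next
    case 3
    then have *: "A - B \<le> 2 * saturation (A - B)" "A - C \<le> 2 * saturation (A - C)"
      using saturation_bounds(3)[of "A - B"] saturation_bounds(3)[of "A - C"] B C by simp_all
    have "difference \<le> 8 * (saturation A)\<^sup>2 * (A - B) * (A - C) * exp A"
      by (rule difference_le_product)
    also have "\<dots> \<le> 8 * (saturation A)\<^sup>2 * (2 * saturation (A - B)) * (2 * saturation (A - C)) * exp A"
    proof -
      have "0 \<le> saturation (A - B)" "0 \<le> saturation (A - C)" "0 \<le> A - B" "0 \<le> A - C"
        using B C by (auto intro: saturation_bounds(1))
      then show ?thesis
        using * by (intro mult_right_mono mult_mono) simp_all
    qed
    finally show ?thesis by (simp add: mult_ac)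
  qed
qed

text \<open>
  The arguments of the factors of \<open>F\<close> are the four products of the heat kernel estimate divided by
  \<open>t\<close>. Since \<open>0 \<le> B, C < A\<close>, the sums \<open>A + B\<close> and \<open>A + C\<close> are comparable to \<open>A\<close>.
\<close>

lemma saturation_factors:
  defines "F \<equiv> saturation (A + C) * saturation (A - C) * saturation (2 * (A - B)) * saturation (2 * (A + B))"
  shows "(saturation A)\<^sup>2 * saturation (A - B) * saturation (A - C) \<le> F"
    and "F \<le> 16 * ((saturation A)\<^sup>2 * saturation (A - B) * saturation (A - C))"
proof -
  have nonneg: "0 \<le> saturation A" "0 \<le> saturation (A - B)" "0 \<le> saturation (A - C)"
      "0 \<le> saturation (A + C)" "0 \<le> saturation (2 * (A - B))"
    using A_pos B C by (simp_all add: saturation_bounds(1))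
  have low: "saturation A \<le> saturation (A + C)" "saturation A \<le> saturation (2 * (A + B))"
      "saturation (A - B) \<le> saturation (2 * (A - B))"
    using B C by (auto intro!: saturation_mono)
  have "saturation (A + C) \<le> saturation (2 * A)" "saturation (2 * (A + B)) \<le> saturation (4 * A)"
    using B C by (auto intro!: saturation_mono)
  then have up: "saturation (A + C) \<le> 2 * saturation A" "saturation (2 * (A + B)) \<le> 4 * saturation A"
      "saturation (2 * (A - B)) \<le> 2 * saturation (A - B)"
    using saturation_scale[of A 2] saturation_scale[of A 4] saturation_scale[of "A - B" 2] A_pos B by auto
  have "saturation A * saturation (A - C) * saturation (A - B) * saturation A \<le> F"
    unfolding F_def using nonneg by (intro mult_mono low order_refl mult_nonneg_nonneg)
  then show "(saturation A)\<^sup>2 * saturation (A - B) * saturation (A - C) \<le> F"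
    by (simp add: power2_eq_square mult_ac)
  have "F \<le> (2 * saturation A) * saturation (A - C) * (2 * saturation (A - B)) * (4 * saturation A)"
    unfolding F_def using nonneg saturation_bounds(1)[of "2 * (A + B)"] A_pos B(1)
    by (intro mult_mono up order_refl mult_nonneg_nonneg) simp_all
  then show "F \<le> 16 * ((saturation A)\<^sup>2 * saturation (A - B) * saturation (A - C))"
    by (simp add: power2_eq_square mult_ac)
qed

end

section \<open>The alternating sum over the Weyl group\<close>

lemma sum_weyl_group_I2_4:
  fixes F :: "(real^2 \<Rightarrow> real^2) \<Rightarrow> real"
  shows "(\<Sum>g\<in>weyl_group_I2_4. F g) =
    (\<Sum>a\<in>{1,-1}. \<Sum>b\<in>{1,-1}. F (\<lambda>x. vector [a * x$1, b * x$2]))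
    + (\<Sum>a\<in>{1,-1}. \<Sum>b\<in>{1,-1}. F (\<lambda>x. vector [a * x$2, b * x$1]))"
proof -
  (* The eight maps are distinct, since they send (1, 2) to eight distinct vectors. *)
  define d :: "real \<times> real \<Rightarrow> real^2 \<Rightarrow> real^2" where "d = (\<lambda>(a, b) x. vector [a * x$1, b * x$2])"
  define w :: "real \<times> real \<Rightarrow> real^2 \<Rightarrow> real^2" where "w = (\<lambda>(a, b) x. vector [a * x$2, b * x$1])"
  let ?S = "{1, -1} \<times> {1, -1 :: real}"
  have W: "weyl_group_I2_4 = d ` ?S \<union> w ` ?S"
    unfolding weyl_group_I2_4_eq signed_perms_def d_def w_def by fast
  have dv: "d c (vector [1, 2]) = vector [fst c, 2 * snd c]"
    and wv: "w c (vector [1, 2]) = vector [2 * fst c, snd c]" for c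
    by (simp_all add: d_def w_def vec2_eq_iff split: prod.split)
  have "inj d" "inj w"
    using dv wv by (auto intro!: injI simp: vec2_eq_iff prod_eq_iff dest!: fun_cong[of _ _ "vector [1, 2]"])
  then have inj: "inj_on d ?S" "inj_on w ?S"
    by (metis inj_on_subset subset_UNIV)+
  have "d c \<noteq> w c'" if "c \<in> ?S" "c' \<in> ?S" for c c'
  proof
    assume "d c = w c'"
    then have "d c (vector [1, 2]) = w c' (vector [1, 2])" by simp
    then show False using that by (auto simp: dv wv vec2_eq_iff)
  qed
  then have disj: "d ` ?S \<inter> w ` ?S = {}" by blast
  have "(\<Sum>g\<in>weyl_group_I2_4. F g) = (\<Sum>g\<in>d ` ?S. F g) + (\<Sum>g\<in>w ` ?S. F g)"
    unfolding W by (rule sum.union_disjoint) (use disj in auto)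
  also have "\<dots> = (\<Sum>c\<in>?S. F (d c)) + (\<Sum>c\<in>?S. F (w c))"
    by (simp only: sum.reindex[OF inj(1)] sum.reindex[OF inj(2)] o_def)
  finally show ?thesis
    by (simp only: sum.cartesian_product[symmetric] d_def w_def case_prod_conv case_prod_unfold fst_conv snd_conv)
      (simp add: sum.cartesian_product' )
qed

lemma det_signed_perms:
  "det (matrix (\<lambda>x::real^2. vector [a * x$1, b * x$2] :: real^2)) = a * b"
  "det (matrix (\<lambda>x::real^2. vector [a * x$2, b * x$1] :: real^2)) = - (a * b)"
  by (auto simp: det_2 matrix_def axis_def)

lemma gauss_weierstrass_eq:
  assumes "0 < t"
  shows "gauss_weierstrass t (w - y) =
    inverse (4 * pi * t) * exp (- ((norm w)\<^sup>2 + (norm y)\<^sup>2) / (4 * t)) * exp (w \<bullet> y / (2 * t))"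
proof -
  have "(norm (w - y))\<^sup>2 = (norm w)\<^sup>2 + (norm y)\<^sup>2 - 2 * (w \<bullet> y)"
    by (simp add: power2_norm_eq_inner inner_diff inner_commute)
  then have "- ((norm (w - y))\<^sup>2 / (4 * t)) = - ((norm w)\<^sup>2 + (norm y)\<^sup>2) / (4 * t) + w \<bullet> y / (2 * t)"
    using assms by (simp add: field_simps)
  then show ?thesis
    by (simp add: gauss_weierstrass_def exp_add)
qed

text \<open>
  Every \<open>g\<close> in the group is an isometry, so all Gaussians share the factor that depends on the
  norms. The diagonal maps give the terms in which \<open>x\<^sub>1\<close> meets \<open>y\<^sub>1\<close>, the swaps those in which
  it meets \<open>y\<^sub>2\<close>. The last argument carries an absolute value, as it plays the part
  of the nonnegative \<open>E\<close> in \<open>cosh_rectangle\<close>.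
\<close>

lemma heat_kernel_det_I2_4_eq:
  fixes x y :: "real^2"
  assumes "0 < t"
  shows "heat_kernel_det_I2_4 t x y =
    inverse (4 * pi * t) * exp (- ((norm x)\<^sup>2 + (norm y)\<^sup>2) / (4 * t)) * 2 *
      (cosh ((x$1 * y$1 + x$2 * y$2) / (2 * t)) - cosh ((x$1 * y$2 + x$2 * y$1) / (2 * t))
       - cosh ((x$1 * y$1 - x$2 * y$2) / (2 * t)) + cosh (\<bar>x$1 * y$2 - x$2 * y$1\<bar> / (2 * t)))"
proof -
  define K where "K = inverse (4 * pi * t) * exp (- ((norm x)\<^sup>2 + (norm y)\<^sup>2) / (4 * t))"
  have n: "(norm (vector [a * x$1, b * x$2] :: real^2))\<^sup>2 = (norm x)\<^sup>2"
      "(norm (vector [a * x$2, b * x$1] :: real^2))\<^sup>2 = (norm x)\<^sup>2"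
    if "a \<in> {1, -1}" "b \<in> {1, -1}" for a b
    using that unfolding power2_norm_eq_inner by (auto simp: inner_vec_def sum_2)
  have "heat_kernel_det_I2_4 t x y =
    (\<Sum>a\<in>{1,-1}. \<Sum>b\<in>{1,-1}. a * b * (K * exp ((a * x$1 * y$1 + b * x$2 * y$2) / (2 * t))))
    + (\<Sum>a\<in>{1,-1}. \<Sum>b\<in>{1,-1}. - (a * b) * (K * exp ((a * x$2 * y$1 + b * x$1 * y$2) / (2 * t))))"
    unfolding heat_kernel_det_I2_4_def sum_weyl_group_I2_4 det_signed_perms K_def
    by (intro arg_cong2[of _ _ _ _ "(+)"] sum.cong refl)
      (simp_all only: gauss_weierstrass_eq[OF assms] n, simp_all add: inner_vec_def sum_2)
  also have "\<dots> = K * 2 * (cosh ((x$1 * y$1 + x$2 * y$2) / (2 * t)) - cosh ((x$1 * y$2 + x$2 * y$1) / (2 * t))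
       - cosh ((x$1 * y$1 - x$2 * y$2) / (2 * t)) + cosh ((x$1 * y$2 - x$2 * y$1) / (2 * t)))"
    by (simp add: cosh_def algebra_simps diff_divide_distrib add_divide_distrib)
  also have "cosh ((x$1 * y$2 - x$2 * y$1) / (2 * t)) = cosh (\<bar>x$1 * y$2 - x$2 * y$1\<bar> / (2 * t))"
  proof -
    have "\<bar>x$1 * y$2 - x$2 * y$1\<bar> / (2 * t) = \<bar>(x$1 * y$2 - x$2 * y$1) / (2 * t)\<bar>"
      using assms by simp
    then show ?thesis by (simp only: cosh_real_abs)
  qed
  finally show ?thesis by (simp add: K_def)
qed

section \<open>The heat kernel estimate\<close>

theorem theorem1p3:
  shows "\<exists>C::real. C > 0 \<and>
    (\<forall>x\<in>weyl_chamber_I2_4. \<forall>y\<in>weyl_chamber_I2_4. \<forall>t::real. t > 0 \<longrightarrow>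
      (let Y = x$1 * y$1 / (x$1 * y$1 + t)
             * (x$2 * y$2 / (x$2 * y$2 + t))
             * ((x$1 - x$2) * (y$1 - y$2) / ((x$1 - x$2) * (y$1 - y$2) + t))
             * ((x$1 + x$2) * (y$1 + y$2) / ((x$1 + x$2) * (y$1 + y$2) + t))
             * gauss_weierstrass t (x - y)
       in inverse C * Y \<le> heat_kernel_det_I2_4 t x y \<and> heat_kernel_det_I2_4 t x y \<le> C * Y))"
  (* The upper bound holds with 2 * 32 = 64. The lower constant combines the 2 of the kernel formula,
     the exp (- 2) / 24 of profile_le_difference and the 1 / 16 lost in saturation_factors. *)
proof (intro exI[of _ "192 * exp 2"] conjI ballI allI impI)
  fix x y :: "real^2" and t :: real
  assume x: "x \<in> weyl_chamber_I2_4" and y: "y \<in> weyl_chamber_I2_4" and t: "0 < t"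
  define A B C E where
    "A = (x$1 * y$1 + x$2 * y$2) / (2 * t)" and "B = (x$1 * y$2 + x$2 * y$1) / (2 * t)" and
    "C = (x$1 * y$1 - x$2 * y$2) / (2 * t)" and "E = \<bar>x$1 * y$2 - x$2 * y$1\<bar> / (2 * t)"
  have pos: "0 < x$1" "0 < x$2" "0 < x$1 - x$2" "0 < y$1" "0 < y$2" "0 < y$1 - y$2"
    using x y by (auto simp: weyl_chamber_I2_4_def)
  have eqs: "x$1 * y$1 = t * (A + C)" "x$2 * y$2 = t * (A - C)"
    "(x$1 - x$2) * (y$1 - y$2) = t * (2 * (A - B))" "(x$1 + x$2) * (y$1 + y$2) = t * (2 * (A + B))"
    using t by (auto simp: A_def B_def C_def field_simps)
  have "cosh_rectangle A B C E"
  proof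
    show "0 \<le> B" "0 \<le> E" using pos t by (auto simp: B_def E_def)
    show "0 \<le> C"
      using pos t mult_mono[of "x$2" "x$1" "y$2" "y$1"] by (simp add: C_def)
    show "B < A" using eqs(3) pos t by (metis diff_gt_0_iff_gt mult_pos_pos zero_less_mult_pos zero_less_numeral)
    show "C < A" using eqs(2) pos t by (metis diff_gt_0_iff_gt mult_pos_pos zero_less_mult_pos)
    show "A\<^sup>2 + E\<^sup>2 = B\<^sup>2 + C\<^sup>2"
      using t by (simp add: A_def B_def C_def E_def power_divide field_simps) algebra
  qed
  then interpret cosh_rectangle A B C E .
  define K where "K = inverse (4 * pi * t) * exp (- ((norm x)\<^sup>2 + (norm y)\<^sup>2) / (4 * t))"
  have K: "0 \<le> K" using t by (simp add: K_def)
  have kernel: "heat_kernel_det_I2_4 t x y = K * 2 * difference"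
    using heat_kernel_det_I2_4_eq[OF t] by (simp add: K_def A_def B_def C_def E_def)
  define F where
    "F = saturation (A + C) * saturation (A - C) * saturation (2 * (A - B)) * saturation (2 * (A + B))"
  define T where "T = (saturation A)\<^sup>2 * saturation (A - B) * saturation (A - C)"
  have factor: "t * m / (t * m + t) = saturation m" if "0 < t * m" for m
  proof -
    have "t * m + t = t * (1 + m)" by (simp add: algebra_simps)
    then show ?thesis using t by (simp add: saturation_def)
  qed
  have "gauss_weierstrass t (x - y) = K * exp A"
    using gauss_weierstrass_eq[OF t] by (simp add: K_def A_def inner_vec_def sum_2)
  then have Y: "x$1 * y$1 / (x$1 * y$1 + t) * (x$2 * y$2 / (x$2 * y$2 + t))
             * ((x$1 - x$2) * (y$1 - y$2) / ((x$1 - x$2) * (y$1 - y$2) + t))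
             * ((x$1 + x$2) * (y$1 + y$2) / ((x$1 + x$2) * (y$1 + y$2) + t))
             * gauss_weierstrass t (x - y) = F * (K * exp A)"
    using pos t B C unfolding eqs F_def by (subst factor, simp)+ simp
  have TF: "T \<le> F" "F \<le> 16 * T"
    unfolding T_def F_def by (rule saturation_factors)+
  have "inverse (192 * exp 2) * (F * (K * exp A)) = 2 * K * (exp (- 2) / 24 * (F / 16 * exp A))"
    by (simp add: exp_minus field_simps)
  also have "\<dots> \<le> 2 * K * (exp (- 2) / 24 * (T * exp A))"
    using TF K by (intro mult_left_mono mult_right_mono) auto
  also have "\<dots> \<le> 2 * K * difference"
    using profile_le_difference K unfolding T_def by (intro mult_left_mono) auto
  finally have lo: "inverse (192 * exp 2) * (F * (K * exp A)) \<le> heat_kernel_det_I2_4 t x y"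
    by (simp add: kernel mult_ac)
  have F0: "0 \<le> F"
    unfolding F_def using B C by (intro mult_nonneg_nonneg saturation_bounds) auto
  have "2 * K * difference \<le> 2 * K * (32 * (T * exp A))"
    using difference_le_profile K unfolding T_def by (intro mult_left_mono) auto
  also have "\<dots> \<le> 2 * K * (32 * (F * exp A))"
    using TF K by (intro mult_left_mono mult_right_mono) auto
  also have "\<dots> = 64 * (F * (K * exp A))" by simp
  also have "\<dots> \<le> (192 * exp 2) * (F * (K * exp A))"
    using F0 K exp_ge_add_one_self[of "2::real"] by (intro mult_right_mono) auto
  finally have up: "heat_kernel_det_I2_4 t x y \<le> (192 * exp 2) * (F * (K * exp A))"
    by (simp add: kernel mult_ac)
  show "let Y = x$1 * y$1 / (x$1 * y$1 + t)
             * (x$2 * y$2 / (x$2 * y$2 + t))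
             * ((x$1 - x$2) * (y$1 - y$2) / ((x$1 - x$2) * (y$1 - y$2) + t))
             * ((x$1 + x$2) * (y$1 + y$2) / ((x$1 + x$2) * (y$1 + y$2) + t))
             * gauss_weierstrass t (x - y)
       in inverse (192 * exp 2) * Y \<le> heat_kernel_det_I2_4 t x y \<and>
          heat_kernel_det_I2_4 t x y \<le> (192 * exp 2) * Y"
    unfolding Let_def Y using lo up by blast
qed simp

end
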